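(* Let $X$ be a compact, connected, locally path connected topological space, let $(M,d_M)$ be a metric space, let $f:X\to M$ be continuous, and let $\epsilon\ge 0$. For all $x,y\in X$, $$\pi_f^\epsilon(x)=\pi_f^\epsilon(y)\quad\text{if and only if}\quad f(x)=f(y)\ \text{ and }\ \rho_f(x,y)\le \epsilon ,$$ where $\rho_f$ is the Reeb radius of $f$ and $\pi_f^\epsilon$ is the $\epsilon$-smoothed Reeb quotient map.
   Context: Reeb radius: $\rho_f(x,y):=\inf_\gamma\sup_{t\in[0,1]} d_M(f(x),f(\gamma(t)))$, the infimum being over all continuous paths $\gamma:[0,1]\to X$ with $\gamma(0)=x$, $\gamma(1)=y$. Reeb space: for a space $Z$ and a continuous map $h:Z\to M$, the Reeb space $R_h$ is the quotient of $Z$ by the relation $z\sim z'$ iff $z$ and $z'$ lie in the same connected component of a level set of $h$. $\epsilon$-smoothing: let $T_f^\epsilon:=\{(x,v)\in X\times M: d_M(f(x),v)\le\epsilon\}$ (subspace topology) and $f^\epsilon:T_f^\epsilon\to M$, $f^\epsilon(x,v):=v$. Let $R_{f^\epsilon}$ be the Reeb space of $(T_f^\epsilon,f^\epsilon)$. The map $\pi_f^\epsilon:X\to R_{f^\epsilon}$ is the composition of the inclusion $X\hookrightarrow T_f^\epsilon$, $x\mapsto (x,f(x))$, with the quotient map, i.e. $\pi_f^\epsilon(x)=[(x,f(x))]$.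
   Formalization: The space X is additionally assumed to be Hausdorff; without this the claim fails, e.g. for [-1,1] with doubled origin, f = |·| and ε = 0, where the two origins have Reeb radius 0 but distinct images. *)

theory Defs
  imports "HOL-Analysis.Analysis"
begin

(* Convention: a "compact" space is compact and Hausdorff.  The Hausdorff condition is needed:
   let X be [-1,1] with doubled origin (origins o, o') and f = |.|.  Paths from o to o' may stay
   arbitrarily close to the origins, so the Reeb radius of o, o' is 0, but the fibre f = 0 is
   the discrete space {o, o'}, so o and o' are distinct in the Reeb space. *)

(* Extended real values, so that the infimum over an empty set of paths is infinity. *)
definition reeb_radius ::
    "'a topology \<Rightarrow> ('b \<Rightarrow> 'b \<Rightarrow> real) \<Rightarrow> ('a \<Rightarrow> 'b) \<Rightarrow> 'a \<Rightarrow> 'a \<Rightarrow> ereal" where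
  "reeb_radius X d f x y =
     (INF \<gamma> \<in> {\<gamma>. pathin X \<gamma> \<and> \<gamma> 0 = x \<and> \<gamma> 1 = y}. SUP t \<in> {0..1}. ereal (d (f x) (f (\<gamma> t))))"

definition reeb_rel :: "'z topology \<Rightarrow> ('z \<Rightarrow> 'b) \<Rightarrow> ('z \<times> 'z) set" where
  "reeb_rel Z h =
     {(z, z'). \<exists>v. \<exists>C \<in> connected_components_of (subtopology Z (h -` {v})). z \<in> C \<and> z' \<in> C}"

definition reeb_proj :: "'z topology \<Rightarrow> ('z \<Rightarrow> 'b) \<Rightarrow> 'z \<Rightarrow> 'z set" where
  "reeb_proj Z h z = reeb_rel Z h `` {z}"

definition reeb_space :: "'z topology \<Rightarrow> ('z \<Rightarrow> 'b) \<Rightarrow> 'z set topology" where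
  "reeb_space Z h = topology (\<lambda>U. U \<subseteq> topspace Z // reeb_rel Z h \<and>
     openin Z {z \<in> topspace Z. reeb_proj Z h z \<in> U})"

definition smoothing_space ::
    "'a topology \<Rightarrow> 'b set \<Rightarrow> ('b \<Rightarrow> 'b \<Rightarrow> real) \<Rightarrow> ('a \<Rightarrow> 'b) \<Rightarrow> real \<Rightarrow> ('a \<times> 'b) topology" where
  "smoothing_space X M d f \<epsilon> =
     subtopology (prod_topology X (Metric_space.mtopology M d))
       {(x, v) \<in> topspace X \<times> M. d (f x) v \<le> \<epsilon>}"

definition smoothed_fun :: "'a \<times> 'b \<Rightarrow> 'b" where
  "smoothed_fun = (\<lambda>(x, v). v)"

definition smoothed_reeb_map ::
    "'a topology \<Rightarrow> 'b set \<Rightarrow> ('b \<Rightarrow> 'b \<Rightarrow> real) \<Rightarrow> ('a \<Rightarrow> 'b) \<Rightarrow> real \<Rightarrow> 'a \<Rightarrow> ('a \<times> 'b) set" where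
  "smoothed_reeb_map X M d f \<epsilon> x =
     reeb_proj (smoothing_space X M d f \<epsilon>) smoothed_fun (x, f x)"

lemma equiv_reeb_rel: "equiv (topspace Z) (reeb_rel Z h)"
proof (rule equivI)
  have C: "C \<subseteq> topspace Z \<inter> h -` {v}"
    if "C \<in> connected_components_of (subtopology Z (h -` {v}))" for C v
    using connected_components_of_subset[OF that] by simp
  show "reeb_rel Z h \<subseteq> topspace Z \<times> topspace Z"
    using C unfolding reeb_rel_def by blast
  show "refl_on (topspace Z) (reeb_rel Z h)"
  proof (rule refl_onI)
    fix z assume "z \<in> topspace Z"
    then have "z \<in> \<Union> (connected_components_of (subtopology Z (h -` {h z})))"
      by (simp add: Union_connected_components_of)
    then show "(z, z) \<in> reeb_rel Z h" unfolding reeb_rel_def by blast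
  qed
  show "sym (reeb_rel Z h)" unfolding reeb_rel_def sym_def by blast
  show "trans (reeb_rel Z h)"
  proof (rule transI)
    fix a b c assume "(a, b) \<in> reeb_rel Z h" "(b, c) \<in> reeb_rel Z h"
    then obtain v C v' C' where *: "C \<in> connected_components_of (subtopology Z (h -` {v}))"
        "a \<in> C" "b \<in> C" "C' \<in> connected_components_of (subtopology Z (h -` {v'}))"
        "b \<in> C'" "c \<in> C'"
      unfolding reeb_rel_def by blast
    moreover have "v = v'" using C[OF *(1)] C[OF *(4)] *(3,5) by auto
    ultimately have "C = C'"
      using connected_components_of_overlap by blast
    with * show "(a, c) \<in> reeb_rel Z h" unfolding reeb_rel_def by blast
  qed
qed

lemma quotient_map_reeb_proj: "quotient_map Z (reeb_space Z h) (reeb_proj Z h)"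
proof -
  let ?P = "\<lambda>U. U \<subseteq> topspace Z // reeb_rel Z h \<and> openin Z {z \<in> topspace Z. reeb_proj Z h z \<in> U}"
  have "istopology ?P"
    unfolding istopology_def
  proof (intro conjI allI impI)
    fix S T assume "?P S" "?P T"
    moreover have "{z \<in> topspace Z. reeb_proj Z h z \<in> S \<inter> T} =
        {z \<in> topspace Z. reeb_proj Z h z \<in> S} \<inter> {z \<in> topspace Z. reeb_proj Z h z \<in> T}" by blast
    ultimately show "S \<inter> T \<subseteq> topspace Z // reeb_rel Z h"
      "openin Z {z \<in> topspace Z. reeb_proj Z h z \<in> S \<inter> T}" by auto
  next
    fix K assume K: "\<forall>U\<in>K. ?P U"
    have "{z \<in> topspace Z. reeb_proj Z h z \<in> \<Union>K} =
        (\<Union>U\<in>K. {z \<in> topspace Z. reeb_proj Z h z \<in> U})" by blast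
    with K show "\<Union>K \<subseteq> topspace Z // reeb_rel Z h"
      "openin Z {z \<in> topspace Z. reeb_proj Z h z \<in> \<Union>K}" by auto
  qed
  then have op: "openin (reeb_space Z h) = ?P"
    unfolding reeb_space_def by (rule topology_inverse')
  have im: "reeb_proj Z h ` topspace Z = topspace Z // reeb_rel Z h"
    unfolding reeb_proj_def quotient_def by blast
  have "{z \<in> topspace Z. reeb_proj Z h z \<in> topspace Z // reeb_rel Z h} = topspace Z"
    using im by blast
  then have "?P (topspace Z // reeb_rel Z h)" by simp
  then have ts: "topspace (reeb_space Z h) = topspace Z // reeb_rel Z h"
    unfolding topspace_def op by blast
  show ?thesis unfolding quotient_map_def ts op im by blast
qed

end

theory Submission
  imports Defs
begin

text \<open>
  Both sides force \<open>f x = f y\<close>; call this value \<open>v\<close> and write \<open>K c = {z. d (f z) v \<le> c}\<close>.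
  The level set of \<open>f\<^sup>\<epsilon>\<close> over \<open>v\<close> is a copy of the sublevel set \<open>K \<epsilon>\<close>, so the theorem compares two relations between \<open>x\<close> and \<open>y\<close>: lying in one
  connected component of \<open>K \<epsilon>\<close>, and being joined by a path in \<open>{z. d (f z) v < \<delta>}\<close> for every
  \<open>\<delta> > \<epsilon>\<close>, which is what \<open>\<rho> \<le> \<epsilon>\<close> says.

  From components to paths, local path connectedness suffices: the strict sublevel set at \<open>\<delta>\<close> is an
  open set containing \<open>K \<epsilon>\<close>, and in an open subset of a locally path connected space connected
  components are path components.

  From paths to components, \<open>x\<close> and \<open>y\<close> lie in one component of \<open>K \<delta>\<close> for each \<open>\<delta> > \<epsilon>\<close>, and
  \<open>K \<epsilon>\<close> is the decreasing intersection of these sets.  If \<open>K \<epsilon>\<close> could be split into two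
  closed pieces separating \<open>x\<close> from \<open>y\<close>, then disjoint open neighbourhoods of the pieces would, by
  compactness, already contain some \<open>K \<delta>\<close> with \<open>\<delta> > \<epsilon>\<close> and separate it too.  Since components and
  quasi-components of the compact Hausdorff space \<open>K \<epsilon>\<close> agree, no such splitting means that
  \<open>x\<close> and \<open>y\<close> are in the same component.
\<close>

section \<open>Components of sublevel sets\<close>

text \<open>
  A connected component of the closed sublevel set is a connected subset of the open set
  \<open>{z. g z < \<delta>}\<close>, whose components are path components.
\<close>

lemma connected_sublevel_imp_path_strict_sublevel:
  fixes g :: "'a \<Rightarrow> real"
  assumes lpc: "locally_path_connected_space X"
    and g: "continuous_map X euclideanreal g"
    and conn: "connected_component_of (subtopology X {z \<in> topspace X. g z \<le> c}) x y"
    and "c < \<delta>"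
  shows "path_component_of (subtopology X {z \<in> topspace X. g z < \<delta>}) x y"
proof -
  let ?U = "{z \<in> topspace X. g z < \<delta>}"
  have "openin X ?U"
    using g by (simp add: continuous_map_upper_lower_semicontinuous_lt)
  then have "locally_path_connected_space (subtopology X ?U)"
    using lpc locally_path_connected_space_open_subset by blast
  moreover have "connected_component_of (subtopology X ?U) x y"
    using conn by (rule connected_component_of_mono) (use \<open>c < \<delta>\<close> in auto)
  ultimately show ?thesis
    by (metis mem_Collect_eq path_component_eq_connected_component_of)
qed

text \<open>
  Components of sublevel sets pass to the limit from above.  This is the step that needs the
  space to be compact Hausdorff: it combines normality, the minimum of \<open>g\<close> on a compact set, and the
  agreement of components with quasi-components.
\<close>

lemma connected_component_sublevel_limit:
  fixes g :: "'a \<Rightarrow> real"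
  assumes "compact_space X" "Hausdorff_space X"
    and g: "continuous_map X euclideanreal g"
    and conn: "\<And>\<delta>. c < \<delta> \<Longrightarrow>
      connected_component_of (subtopology X {z \<in> topspace X. g z \<le> \<delta>}) x y"
    and xy: "x \<in> topspace X" "g x \<le> c" "y \<in> topspace X" "g y \<le> c"
  shows "connected_component_of (subtopology X {z \<in> topspace X. g z \<le> c}) x y"
proof -
  let ?K = "\<lambda>\<delta>. {z \<in> topspace X. g z \<le> \<delta>}"
  have closedK: "closedin X (?K c)"
    using g by (simp add: continuous_map_upper_lower_semicontinuous_le)
  have "compact_space (subtopology X (?K c))"
    using \<open>compact_space X\<close> closedK by (simp add: closedin_compact_space compact_space_subtopology)
  moreover have "Hausdorff_space (subtopology X (?K c))"
    using \<open>Hausdorff_space X\<close> by (rule Hausdorff_space_subtopology)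
  ultimately have quasi: "quasi_component_of (subtopology X (?K c)) x
      = connected_component_of (subtopology X (?K c)) x"
    by (intro quasi_eq_connected_component_of) blast
  have "quasi_component_of (subtopology X (?K c)) x y"
    unfolding quasi_component_of_def
  proof (intro conjI allI impI)
    fix A assume A: "closedin (subtopology X (?K c)) A \<and> openin (subtopology X (?K c)) A"
    define B where "B = ?K c - A"
    have topK: "topspace (subtopology X (?K c)) = ?K c" by auto
    have "closedin (subtopology X (?K c)) B"
      using A closedin_diff[OF closedin_topspace] unfolding B_def by (metis (lifting) topK)
    then have "closedin X A" "closedin X B"
      using A closedK closedin_trans_full by blast+
    moreover have "disjnt A B" by (auto simp: B_def disjnt_def)
    moreover have "normal_space X"
      using assms(1,2) compact_Hausdorff_or_regular_imp_normal_space by blast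
    ultimately obtain U V where UV: "openin X U" "openin X V" "A \<subseteq> U" "B \<subseteq> V" "disjnt U V"
      unfolding normal_space_def by meson
    define R where "R = topspace X - (U \<union> V)"
    have "compactin X R"
      using UV \<open>compact_space X\<close> by (simp add: R_def closedin_compact_space openin_Un closedin_diff)
    then have "compact (g ` R)"
      using image_compactin[OF _ g] by (simp add: compactin_euclidean_iff)
    have gR: "c < g z" if "z \<in> R" for z
      using that UV(3,4) by (force simp: R_def B_def)
    \<comment> \<open>Halfway between \<open>c\<close> and the minimum of \<open>g\<close> outside \<open>U \<union> V\<close>, the sublevel set
      has not yet left \<open>U \<union> V\<close>.\<close>
    obtain \<delta> where "c < \<delta>" and \<delta>: "\<And>z. z \<in> R \<Longrightarrow> \<delta> < g z"
    proof (cases "R = {}")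
      case True
      with that[of "c + 1"] show ?thesis by simp
    next
      case False
      then obtain m where m: "m \<in> R" "\<forall>z\<in>R. g m \<le> g z"
        using compact_attains_inf[OF \<open>compact (g ` R)\<close>] by blast
      have "c < g m" using gR m(1) .
      show ?thesis
      proof (rule that[of "(c + g m) / 2"])
        show "c < (c + g m) / 2" using \<open>c < g m\<close> by simp
        show "(c + g m) / 2 < g z" if "z \<in> R" for z
          using \<open>c < g m\<close> bspec[OF m(2) that] by simp
      qed
    qed
    from conn[OF \<open>c < \<delta>\<close>] obtain T
      where T: "connectedin (subtopology X (?K \<delta>)) T" "x \<in> T" "y \<in> T"
      unfolding connected_component_of_def by blast
    then have "connectedin X T" "T \<subseteq> ?K \<delta>"
      by (auto simp: connectedin_subtopology)
    then have "T \<subseteq> U \<union> V"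
      using \<delta> by (force simp: R_def)
    then have sideT: "T \<subseteq> U \<or> T \<subseteq> V"
      using \<open>connectedin X T\<close> UV(1,2,5) unfolding connectedin disjnt_def
      by blast
    have "x \<in> A \<union> B" "y \<in> A \<union> B" using xy by (auto simp: B_def)
    then show "(x \<in> A) = (y \<in> A)"
      using sideT T(2,3) UV(3,4,5) unfolding disjnt_iff by blast
  qed (use xy in auto)
  then show ?thesis by (simp add: quasi)
qed

section \<open>The two relations as statements about sublevel sets\<close>

lemma reeb_proj_eq_iff:
  assumes "z \<in> topspace Z" "z' \<in> topspace Z"
  shows "reeb_proj Z h z = reeb_proj Z h z' \<longleftrightarrow>
    h z = h z' \<and> connected_component_of (subtopology Z (h -` {h z})) z z'"
proof -
  have "reeb_proj Z h z = reeb_proj Z h z' \<longleftrightarrow> (z, z') \<in> reeb_rel Z h"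
    unfolding reeb_proj_def by (rule eq_equiv_class_iff[OF equiv_reeb_rel assms])
  also have "\<dots> \<longleftrightarrow> (\<exists>v. connected_component_of (subtopology Z (h -` {v})) z z')"
  proof -
    have "(\<exists>C \<in> connected_components_of S. z \<in> C \<and> z' \<in> C) \<longleftrightarrow> connected_component_of S z z'"
      for S :: "'a topology"
    proof
      assume "connected_component_of S z z'"
      then show "\<exists>C \<in> connected_components_of S. z \<in> C \<and> z' \<in> C"
        by (intro bexI[of _ "connected_component_of_set S z"])
          (auto simp: connected_component_of_refl connected_component_in_connected_components_of
            dest: connected_component_in_topspace)
    qed (auto simp: connected_component_of_def dest: connectedin_connected_components_of)
    then show ?thesis by (simp add: reeb_rel_def)
  qed
  also have "\<dots> \<longleftrightarrow> h z = h z' \<and> connected_component_of (subtopology Z (h -` {h z})) z z'"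
  proof -
    have "h z = v \<and> h z' = v" if "connected_component_of (subtopology Z (h -` {v})) z z'" for v
      using connected_component_in_topspace[OF that] by simp
    then show ?thesis by metis
  qed
  finally show ?thesis .
qed

text \<open>
  The maps \<open>fst\<close> and \<open>z \<mapsto> (z, v)\<close> identify the level set of the smoothed function over \<open>v\<close> with a
  sublevel set in the original space.
\<close>

lemma connected_component_smoothed_level_iff:
  assumes "Metric_space M d" "v \<in> M"
  shows "connected_component_of
      (subtopology (smoothing_space X M d f \<epsilon>) (smoothed_fun -` {v})) (x, v) (y, v) \<longleftrightarrow>
    connected_component_of (subtopology X {z \<in> topspace X. d (f z) v \<le> \<epsilon>}) x y"
    (is "connected_component_of ?L _ _ \<longleftrightarrow> connected_component_of ?K _ _")
proof
  have top: "topspace (Metric_space.mtopology M d) = M"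
    using assms(1) by (rule Metric_space.topspace_mtopology)
  have fst_cont: "continuous_map ?L ?K fst"
    by (auto simp: smoothing_space_def smoothed_fun_def continuous_map_in_subtopology
        subtopology_subtopology top intro!: continuous_map_from_subtopology continuous_map_fst)
  have pair_cont: "continuous_map ?K ?L (\<lambda>z. (z, v))"
    using \<open>v \<in> M\<close>
    by (auto simp: smoothing_space_def smoothed_fun_def continuous_map_in_subtopology
        subtopology_subtopology top intro!: continuous_map_pairedI
        continuous_map_from_subtopology)
  show "connected_component_of ?K x y" if "connected_component_of ?L (x, v) (y, v)"
    using that connectedin_continuous_map_image[OF fst_cont]
    unfolding connected_component_of_def by force
  show "connected_component_of ?L (x, v) (y, v)" if "connected_component_of ?K x y"
    using that connectedin_continuous_map_image[OF pair_cont]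
    unfolding connected_component_of_def by blast
qed

text \<open>
  The infimum in the Reeb radius need not be attained, so it is tested against all \<open>\<delta> > \<epsilon>\<close>.
\<close>

lemma reeb_radius_le_iff_path_component:
  "reeb_radius X d f x y \<le> ereal \<epsilon> \<longleftrightarrow>
    (\<forall>\<delta>>\<epsilon>. path_component_of (subtopology X {z \<in> topspace X. d (f x) (f z) < \<delta>}) x y)"
proof (intro iffI allI impI)
  fix \<delta> assume "reeb_radius X d f x y \<le> ereal \<epsilon>" "\<epsilon> < \<delta>"
  then have "reeb_radius X d f x y < ereal \<delta>"
    by (metis le_less_trans less_ereal.simps(1))
  then obtain \<gamma> where \<gamma>: "pathin X \<gamma>" "\<gamma> 0 = x" "\<gamma> 1 = y"
    and sup: "(SUP t \<in> {0..1}. ereal (d (f x) (f (\<gamma> t)))) < ereal \<delta>"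
    unfolding reeb_radius_def by (auto simp: INF_less_iff)
  have "d (f x) (f (\<gamma> t)) < \<delta>" if "t \<in> {0..1}" for t
    using le_less_trans[OF SUP_upper[OF that] sup] by simp
  moreover have "\<gamma> t \<in> topspace X" if "t \<in> {0..1}" for t
    using path_image_subset_topspace[OF \<gamma>(1)] that by blast
  ultimately have "pathin (subtopology X {z \<in> topspace X. d (f x) (f z) < \<delta>}) \<gamma>"
    using \<gamma>(1) by (simp add: pathin_subtopology)
  with \<gamma>(2,3) show "path_component_of (subtopology X {z \<in> topspace X. d (f x) (f z) < \<delta>}) x y"
    unfolding path_component_of_def by blast
next
  assume paths: "\<forall>\<delta>>\<epsilon>. path_component_of
    (subtopology X {z \<in> topspace X. d (f x) (f z) < \<delta>}) x y"
  have "reeb_radius X d f x y \<le> ereal \<delta>" if "\<epsilon> < \<delta>" for \<delta>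
  proof -
    have "path_component_of (subtopology X {z \<in> topspace X. d (f x) (f z) < \<delta>}) x y"
      using paths that by blast
    then obtain \<gamma> where \<gamma>: "pathin X \<gamma>" "\<gamma> 0 = x" "\<gamma> 1 = y"
      and below: "\<forall>t\<in>{0..1}. d (f x) (f (\<gamma> t)) < \<delta>"
      unfolding path_component_of_def by (auto simp: pathin_subtopology)
    show ?thesis
      unfolding reeb_radius_def
    proof (rule INF_lower2)
      show "\<gamma> \<in> {\<gamma>. pathin X \<gamma> \<and> \<gamma> 0 = x \<and> \<gamma> 1 = y}" using \<gamma> by simp
      show "(SUP t \<in> {0..1}. ereal (d (f x) (f (\<gamma> t)))) \<le> ereal \<delta>"
        using below by (intro SUP_least) (simp add: less_imp_le)
    qed
  qed
  then show "reeb_radius X d f x y \<le> ereal \<epsilon>"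
    by - (rule ereal_le_epsilon2, simp)
qed

section \<open>The smoothed Reeb quotient and the Reeb radius\<close>

theorem theorem2:
  fixes X :: "'a topology" and M :: "'b set" and d :: "'b \<Rightarrow> 'b \<Rightarrow> real"
    and f :: "'a \<Rightarrow> 'b" and \<epsilon> :: real and x y :: 'a
  assumes "compact_space X" and "Hausdorff_space X" and "connected_space X"
    and "locally_path_connected_space X"
    and "Metric_space M d"
    and "continuous_map X (Metric_space.mtopology M d) f"
    and "0 \<le> \<epsilon>"
    and "x \<in> topspace X" and "y \<in> topspace X"
  shows "smoothed_reeb_map X M d f \<epsilon> x = smoothed_reeb_map X M d f \<epsilon> y \<longleftrightarrow>
    f x = f y \<and> reeb_radius X d f x y \<le> ereal \<epsilon>"
proof -
  interpret Metric_space M d by fact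
  have fM: "f z \<in> M" if "z \<in> topspace X" for z
    using assms(6) that by (auto simp: continuous_map_def)
  define g where "g z = d (f x) (f z)" for z
  have g: "continuous_map X euclideanreal g"
  proof -
    have "continuous_map X euclideanreal
        (\<lambda>z. mdist (metric (M, d)) (f x) (f z))"
      using assms(6,8) fM by (intro continuous_map_mdist) (auto simp: mtopology_of_def)
    then show ?thesis by (simp add: g_def[abs_def])
  qed
  have sublevel: "{z \<in> topspace X. d (f z) (f x) \<le> \<epsilon>} = {z \<in> topspace X. g z \<le> \<epsilon>}"
    by (simp add: g_def commute)
  have "(z, f z) \<in> topspace (smoothing_space X M d f \<epsilon>)" if "z \<in> topspace X" for z
    using that fM assms(7) by (simp add: smoothing_space_def)
  then have "smoothed_reeb_map X M d f \<epsilon> x = smoothed_reeb_map X M d f \<epsilon> y \<longleftrightarrow>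
      f x = f y \<and> connected_component_of (subtopology (smoothing_space X M d f \<epsilon>)
        (smoothed_fun -` {f x})) (x, f x) (y, f y)"
    unfolding smoothed_reeb_map_def
    using assms(8,9) by (simp add: reeb_proj_eq_iff smoothed_fun_def)
  also have "\<dots> \<longleftrightarrow> f x = f y \<and>
      connected_component_of (subtopology X {z \<in> topspace X. g z \<le> \<epsilon>}) x y"
    using connected_component_smoothed_level_iff[OF assms(5) fM[OF assms(8)], of X f \<epsilon> x y]
    by (auto simp: sublevel)
  also have "\<dots> \<longleftrightarrow> f x = f y \<and>
      (\<forall>\<delta>>\<epsilon>. path_component_of (subtopology X {z \<in> topspace X. g z < \<delta>}) x y)"
  proof (intro conj_cong refl iffI allI impI)
    fix \<delta> assume "connected_component_of (subtopology X {z \<in> topspace X. g z \<le> \<epsilon>}) x y" "\<epsilon> < \<delta>"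
    then show "path_component_of (subtopology X {z \<in> topspace X. g z < \<delta>}) x y"
      by (rule connected_sublevel_imp_path_strict_sublevel[OF assms(4) g])
  next
    assume eq: "f x = f y"
      and paths: "\<forall>\<delta>>\<epsilon>. path_component_of (subtopology X {z \<in> topspace X. g z < \<delta>}) x y"
    have conn: "connected_component_of (subtopology X {z \<in> topspace X. g z \<le> \<delta>}) x y"
      if "\<epsilon> < \<delta>" for \<delta>
    proof -
      have "path_component_of (subtopology X {z \<in> topspace X. g z < \<delta>}) x y"
        using paths that by blast
      then have "connected_component_of (subtopology X {z \<in> topspace X. g z < \<delta>}) x y"
        by (meson mem_Collect_eq path_component_subset_connected_component_of subsetD)
      then show ?thesis by (rule connected_component_of_mono) auto
    qed
    have le: "g x \<le> \<epsilon>" "g y \<le> \<epsilon>"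
      using assms(7) fM[OF assms(8)] unfolding g_def eq[symmetric] by simp_all
    show "connected_component_of (subtopology X {z \<in> topspace X. g z \<le> \<epsilon>}) x y"
      by (rule connected_component_sublevel_limit[OF assms(1,2) g conn assms(8) le(1) assms(9) le(2)])
  qed
  also have "\<dots> \<longleftrightarrow> f x = f y \<and> reeb_radius X d f x y \<le> ereal \<epsilon>"
    by (simp add: reeb_radius_le_iff_path_component g_def)
  finally show ?thesis .
qed

end
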